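(* Let $F$ be a fragment of first-order logic that enjoys Craig interpolation, let $\Sigma$ be a signature and let $\varphi_1,\varphi_2$ be $F$-sentences. If $\varphi_1$ $F(\Sigma)$-entails $\varphi_2$, then $\varphi_1$ strongly $F(\Sigma)$-entails $\varphi_2$. In particular, if $\varphi_2\models\varphi_1$ and $\mathsf{sig}(\varphi_1)\subseteq\Sigma$, then $\varphi_1$ is a uniform $F(\Sigma)$-interpolant of $\varphi_2$ if and only if $\varphi_1$ $F(\Sigma)$-entails $\varphi_2$.
   Context: All logics are fragments of first-order logic (FO) over relational signatures, with equality, without constants and function symbols. A signature is a finite set of predicates; equality is a logical symbol and never part of a signature. $\mathsf{sig}(\varphi)$ is the set of predicates occurring in $\varphi$, and $F(\Sigma)$ is the set of $F$-sentences using only predicates from $\Sigma$ (and possibly equality). For $F$-sentences $\varphi_1,\varphi_2$: $\varphi_1$ $F(\Sigma)$-entails $\varphi_2$ if for every $F(\Sigma)$-sentence $\psi$, $\varphi_2\models\psi$ implies $\varphi_1\models\psi$. $\varphi_1$ strongly $F(\Sigma)$-entails $\varphi_2$ if $\varphi_1$ $F(\Sigma')$-entails $\varphi_2$ for every signature $\Sigma'$ with $\Sigma'\cap\mathsf{sig}(\varphi_2)\subseteq\Sigma$. $F$ has Craig interpolation if for all $F$-sentences $\psi_1,\psi_2$ with $\psi_1\models\psi_2$ there is an $F$-sentence $\psi$ with $\psi_1\models\psi\models\psi_2$ and $\mathsf{sig}(\psi)\subseteq\mathsf{sig}(\psi_1)\cap\mathsf{sig}(\psi_2)$. Given an $F$-sentence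 $\psi_1$ and an $F$-sentence $\psi$ with $\psi_1\models\psi$ and $\mathsf{sig}(\psi)\subseteq\Sigma$, $\psi$ is a uniform $F(\Sigma)$-interpolant of $\psi_1$ iff $\psi$ strongly $F(\Sigma)$-entails $\psi_1$ (equivalently: for every $F$-sentence $\chi$ with $\mathsf{sig}(\chi)\cap\mathsf{sig}(\psi_1)\subseteq\Sigma$ and $\psi_1\models\chi$ one has $\psi\models\chi$). *)

theory Defs
  imports "HOL-Library.Countable_Set" "HOL-Library.Infinite_Typeclass"
begin

datatype 'p fm =
    Bot
  | Top
  | Pred 'p "nat list"
  | Eq nat nat
  | Neg "'p fm"
  | Conj "'p fm" "'p fm"
  | Disj "'p fm" "'p fm"
  | Imp "'p fm" "'p fm"
  | Ex nat "'p fm"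
  | All nat "'p fm"

primrec fv :: "'p fm \<Rightarrow> nat set" where
  "fv Bot = {}"
| "fv Top = {}"
| "fv (Pred P xs) = set xs"
| "fv (Eq x y) = {x, y}"
| "fv (Neg \<phi>) = fv \<phi>"
| "fv (Conj \<phi> \<psi>) = fv \<phi> \<union> fv \<psi>"
| "fv (Disj \<phi> \<psi>) = fv \<phi> \<union> fv \<psi>"
| "fv (Imp \<phi> \<psi>) = fv \<phi> \<union> fv \<psi>"
| "fv (Ex x \<phi>) = fv \<phi> - {x}"
| "fv (All x \<phi>) = fv \<phi> - {x}"

primrec sig :: "'p fm \<Rightarrow> 'p set" where
  "sig Bot = {}"
| "sig Top = {}"
| "sig (Pred P xs) = {P}"
| "sig (Eq x y) = {}"
| "sig (Neg \<phi>) = sig \<phi>"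
| "sig (Conj \<phi> \<psi>) = sig \<phi> \<union> sig \<psi>"
| "sig (Disj \<phi> \<psi>) = sig \<phi> \<union> sig \<psi>"
| "sig (Imp \<phi> \<psi>) = sig \<phi> \<union> sig \<psi>"
| "sig (Ex x \<phi>) = sig \<phi>"
| "sig (All x \<phi>) = sig \<phi>"

primrec wff :: "('p \<Rightarrow> nat) \<Rightarrow> 'p fm \<Rightarrow> bool" where
  "wff ar Bot \<longleftrightarrow> True"
| "wff ar Top \<longleftrightarrow> True"
| "wff ar (Pred P xs) \<longleftrightarrow> length xs = ar P"
| "wff ar (Eq x y) \<longleftrightarrow> True"
| "wff ar (Neg \<phi>) \<longleftrightarrow> wff ar \<phi>"
| "wff ar (Conj \<phi> \<psi>) \<longleftrightarrow> wff ar \<phi> \<and> wff ar \<psi>"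
| "wff ar (Disj \<phi> \<psi>) \<longleftrightarrow> wff ar \<phi> \<and> wff ar \<psi>"
| "wff ar (Imp \<phi> \<psi>) \<longleftrightarrow> wff ar \<phi> \<and> wff ar \<psi>"
| "wff ar (Ex x \<phi>) \<longleftrightarrow> wff ar \<phi>"
| "wff ar (All x \<phi>) \<longleftrightarrow> wff ar \<phi>"

text \<open>
  A structure is a nonempty domain \<open>D\<close> together with an interpretation \<open>I\<close> of the predicates.
  Well-formed formulas only inspect \<open>I P\<close> on tuples over \<open>D\<close> whose length is the arity of \<open>P\<close>.
\<close>

primrec sat :: "'u set \<Rightarrow> ('p \<Rightarrow> 'u list \<Rightarrow> bool) \<Rightarrow> (nat \<Rightarrow> 'u) \<Rightarrow> 'p fm \<Rightarrow> bool" where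
  "sat D I e Bot \<longleftrightarrow> False"
| "sat D I e Top \<longleftrightarrow> True"
| "sat D I e (Pred P xs) \<longleftrightarrow> I P (map e xs)"
| "sat D I e (Eq x y) \<longleftrightarrow> e x = e y"
| "sat D I e (Neg \<phi>) \<longleftrightarrow> \<not> sat D I e \<phi>"
| "sat D I e (Conj \<phi> \<psi>) \<longleftrightarrow> sat D I e \<phi> \<and> sat D I e \<psi>"
| "sat D I e (Disj \<phi> \<psi>) \<longleftrightarrow> sat D I e \<phi> \<or> sat D I e \<psi>"
| "sat D I e (Imp \<phi> \<psi>) \<longleftrightarrow> (sat D I e \<phi> \<longrightarrow> sat D I e \<psi>)"
| "sat D I e (Ex x \<phi>) \<longleftrightarrow> (\<exists>d\<in>D. sat D I (e(x := d)) \<phi>)"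
| "sat D I e (All x \<phi>) \<longleftrightarrow> (\<forall>d\<in>D. sat D I (e(x := d)) \<phi>)"

text \<open>
  HOL cannot quantify over the type of the domain elements inside a definition, so entailment
  takes this type as a parameter. For an infinite type \<open>'u\<close> the choice is immaterial: by
  the Loewenheim-Skolem argument below (\<open>entails_any_structure\<close>), entailment between
  sentences then coincides with entailment over structures of arbitrary types.
\<close>

definition entails :: "'u itself \<Rightarrow> 'p fm \<Rightarrow> 'p fm \<Rightarrow> bool" where
  "entails U \<phi> \<psi> \<longleftrightarrow>
     (\<forall>(D :: 'u set) I e. D \<noteq> {} \<longrightarrow> range e \<subseteq> D \<longrightarrow> sat D I e \<phi> \<longrightarrow> sat D I e \<psi>)"

definition fragment :: "('p \<Rightarrow> nat) \<Rightarrow> 'p fm set \<Rightarrow> bool" where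
  "fragment ar F \<longleftrightarrow> (\<forall>\<phi>\<in>F. wff ar \<phi>)"

definition sentences :: "'p fm set \<Rightarrow> 'p fm set" where
  "sentences F = {\<phi> \<in> F. fv \<phi> = {}}"

definition sentences_over :: "'p fm set \<Rightarrow> 'p set \<Rightarrow> 'p fm set" where
  "sentences_over F \<Sigma> = {\<phi> \<in> sentences F. sig \<phi> \<subseteq> \<Sigma>}"

definition sig_entails :: "'u itself \<Rightarrow> 'p fm set \<Rightarrow> 'p set \<Rightarrow> 'p fm \<Rightarrow> 'p fm \<Rightarrow> bool" where
  "sig_entails U F \<Sigma> \<phi>\<^sub>1 \<phi>\<^sub>2 \<longleftrightarrow>
     (\<forall>\<psi> \<in> sentences_over F \<Sigma>. entails U \<phi>\<^sub>2 \<psi> \<longrightarrow> entails U \<phi>\<^sub>1 \<psi>)"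

text \<open>Signatures are finite sets of predicates.\<close>

definition strongly_sig_entails ::
  "'u itself \<Rightarrow> 'p fm set \<Rightarrow> 'p set \<Rightarrow> 'p fm \<Rightarrow> 'p fm \<Rightarrow> bool" where
  "strongly_sig_entails U F \<Sigma> \<phi>\<^sub>1 \<phi>\<^sub>2 \<longleftrightarrow>
     (\<forall>\<Sigma>'. finite \<Sigma>' \<longrightarrow> \<Sigma>' \<inter> sig \<phi>\<^sub>2 \<subseteq> \<Sigma> \<longrightarrow> sig_entails U F \<Sigma>' \<phi>\<^sub>1 \<phi>\<^sub>2)"

definition craig_interpolation :: "'u itself \<Rightarrow> 'p fm set \<Rightarrow> bool" where
  "craig_interpolation U F \<longleftrightarrow>
     (\<forall>\<psi>\<^sub>1 \<in> sentences F. \<forall>\<psi>\<^sub>2 \<in> sentences F. entails U \<psi>\<^sub>1 \<psi>\<^sub>2 \<longrightarrow>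
        (\<exists>\<psi> \<in> sentences F. entails U \<psi>\<^sub>1 \<psi> \<and> entails U \<psi> \<psi>\<^sub>2 \<and> sig \<psi> \<subseteq> sig \<psi>\<^sub>1 \<inter> sig \<psi>\<^sub>2))"

text \<open>\<open>uniform_interpolant U F \<Sigma> \<psi>\<^sub>1 \<psi>\<close>: \<open>\<psi>\<close> is a uniform interpolant of \<open>\<psi>\<^sub>1\<close>.\<close>

definition uniform_interpolant ::
  "'u itself \<Rightarrow> 'p fm set \<Rightarrow> 'p set \<Rightarrow> 'p fm \<Rightarrow> 'p fm \<Rightarrow> bool" where
  "uniform_interpolant U F \<Sigma> \<psi>\<^sub>1 \<psi> \<longleftrightarrow>
     \<psi>\<^sub>1 \<in> sentences F \<and> \<psi> \<in> sentences F \<and> entails U \<psi>\<^sub>1 \<psi> \<and> sig \<psi> \<subseteq> \<Sigma> \<and>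
     strongly_sig_entails U F \<Sigma> \<psi> \<psi>\<^sub>1"

lemma finite_sig: "finite (sig \<phi>)"
  by (induction \<phi>) auto

lemma uniform_interpolant_iff:
  "uniform_interpolant U F \<Sigma> \<psi>\<^sub>1 \<psi> \<longleftrightarrow>
     \<psi>\<^sub>1 \<in> sentences F \<and> \<psi> \<in> sentences F \<and> entails U \<psi>\<^sub>1 \<psi> \<and> sig \<psi> \<subseteq> \<Sigma> \<and>
     (\<forall>\<chi> \<in> sentences F. sig \<chi> \<inter> sig \<psi>\<^sub>1 \<subseteq> \<Sigma> \<longrightarrow> entails U \<psi>\<^sub>1 \<chi> \<longrightarrow> entails U \<psi> \<chi>)"
proof -
  have "strongly_sig_entails U F \<Sigma> \<psi> \<psi>\<^sub>1 \<longleftrightarrow>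
     (\<forall>\<chi> \<in> sentences F. sig \<chi> \<inter> sig \<psi>\<^sub>1 \<subseteq> \<Sigma> \<longrightarrow> entails U \<psi>\<^sub>1 \<chi> \<longrightarrow> entails U \<psi> \<chi>)"
    (is "?L \<longleftrightarrow> ?R")
  proof
    assume ?L
    then show ?R
      using finite_sig
      unfolding strongly_sig_entails_def sig_entails_def sentences_over_def by blast
  next
    assume ?R
    then show ?L
      unfolding strongly_sig_entails_def sig_entails_def sentences_over_def by blast
  qed
  then show ?thesis unfolding uniform_interpolant_def by blast
qed

subsection \<open>Independence of the domain type\<close>

lemma finite_fv: "finite (fv \<phi>)"
  by (induction \<phi>) auto

lemma sat_cong: "(\<And>x. x \<in> fv \<phi> \<Longrightarrow> e x = e' x) \<Longrightarrow> sat D I e \<phi> \<longleftrightarrow> sat D I e' \<phi>"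
proof (induction \<phi> arbitrary: e e')
  case (Pred P xs)
  then have "map e xs = map e' xs" by auto
  then show ?case by (simp del: map_eq_conv)
next
  case (Neg \<phi>)
  then have "sat D I e \<phi> \<longleftrightarrow> sat D I e' \<phi>" by (intro Neg.IH) auto
  then show ?case by simp
next
  case (Conj \<phi> \<psi>)
  have "sat D I e \<phi> \<longleftrightarrow> sat D I e' \<phi>" by (rule Conj.IH(1)) (simp add: Conj.prems)
  moreover have "sat D I e \<psi> \<longleftrightarrow> sat D I e' \<psi>" by (rule Conj.IH(2)) (simp add: Conj.prems)
  ultimately show ?case by simp
next
  case (Disj \<phi> \<psi>)
  have "sat D I e \<phi> \<longleftrightarrow> sat D I e' \<phi>" by (rule Disj.IH(1)) (simp add: Disj.prems)
  moreover have "sat D I e \<psi> \<longleftrightarrow> sat D I e' \<psi>" by (rule Disj.IH(2)) (simp add: Disj.prems)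
  ultimately show ?case by simp
next
  case (Imp \<phi> \<psi>)
  have "sat D I e \<phi> \<longleftrightarrow> sat D I e' \<phi>" by (rule Imp.IH(1)) (simp add: Imp.prems)
  moreover have "sat D I e \<psi> \<longleftrightarrow> sat D I e' \<psi>" by (rule Imp.IH(2)) (simp add: Imp.prems)
  ultimately show ?case by simp
next
  case (Ex x \<phi>)
  have "sat D I (e(x := d)) \<phi> \<longleftrightarrow> sat D I (e'(x := d)) \<phi>" for d
    by (rule Ex.IH) (simp add: Ex.prems)
  then show ?case by simp
next
  case (All x \<phi>)
  have "sat D I (e(x := d)) \<phi> \<longleftrightarrow> sat D I (e'(x := d)) \<phi>" for d
    by (rule All.IH) (simp add: All.prems)
  then show ?case by simp
qed auto

lemma sat_image:
  assumes f: "inj_on f D"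
  shows "range e \<subseteq> D \<Longrightarrow>
    sat (f ` D) (\<lambda>P us. I P (map (inv_into D f) us)) (f \<circ> e) \<phi> \<longleftrightarrow> sat D I e \<phi>"
proof (induction \<phi> arbitrary: e)
  case (Pred P xs)
  have "inv_into D f (f (e x)) = e x" for x
    using Pred f by (auto intro!: inv_into_f_f)
  then show ?case by (simp add: comp_def)
next
  case (Eq x y)
  then show ?case using f by (auto dest!: inj_onD)
next
  case (Ex x \<phi>)
  have "sat (f ` D) (\<lambda>P us. I P (map (inv_into D f) us)) ((f \<circ> e)(x := f d)) \<phi> \<longleftrightarrow>
      sat D I (e(x := d)) \<phi>" if "d \<in> D" for d
  proof -
    have "range (e(x := d)) \<subseteq> D" using Ex.prems that by auto
    from Ex.IH[OF this] show ?thesis by (simp only: fun_upd_comp)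
  qed
  then show ?case by (simp del: o_apply comp_apply add: comp_def)
next
  case (All x \<phi>)
  have "sat (f ` D) (\<lambda>P us. I P (map (inv_into D f) us)) ((f \<circ> e)(x := f d)) \<phi> \<longleftrightarrow>
      sat D I (e(x := d)) \<phi>" if "d \<in> D" for d
  proof -
    have "range (e(x := d)) \<subseteq> D" using All.prems that by auto
    from All.IH[OF this] show ?thesis by (simp only: fun_upd_comp)
  qed
  then show ?case by (simp del: o_apply comp_apply add: comp_def)
qed auto

primrec qsub :: "'p fm \<Rightarrow> 'p fm set" where
  "qsub Bot = {}"
| "qsub Top = {}"
| "qsub (Pred P xs) = {}"
| "qsub (Eq x y) = {}"
| "qsub (Neg \<phi>) = qsub \<phi>"
| "qsub (Conj \<phi> \<psi>) = qsub \<phi> \<union> qsub \<psi>"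
| "qsub (Disj \<phi> \<psi>) = qsub \<phi> \<union> qsub \<psi>"
| "qsub (Imp \<phi> \<psi>) = qsub \<phi> \<union> qsub \<psi>"
| "qsub (Ex x \<phi>) = insert \<phi> (qsub \<phi>)"
| "qsub (All x \<phi>) = insert (Neg \<phi>) (qsub \<phi>)"

lemma finite_qsub: "finite (qsub \<phi>)"
  by (induction \<phi>) auto

lemma Tarski_Vaught:
  assumes "H \<subseteq> D"
    and wit: "\<And>\<phi> x e. \<phi> \<in> S \<Longrightarrow> range e \<subseteq> H \<Longrightarrow> \<exists>d\<in>D. sat D I (e(x := d)) \<phi> \<Longrightarrow>
               \<exists>d\<in>H. sat D I (e(x := d)) \<phi>"
  shows "qsub \<phi> \<subseteq> S \<Longrightarrow> range e \<subseteq> H \<Longrightarrow> sat H I e \<phi> \<longleftrightarrow> sat D I e \<phi>"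
proof (induction \<phi> arbitrary: e)
  case (Ex x \<phi>)
  have upd: "range (e(x := d)) \<subseteq> H" if "d \<in> H" for d using Ex.prems that by auto
  have IH: "sat H I (e(x := d)) \<phi> \<longleftrightarrow> sat D I (e(x := d)) \<phi>" if "d \<in> H" for d
    by (rule Ex.IH[OF _ upd[OF that]]) (use Ex.prems in auto)
  have "\<phi> \<in> S" using Ex.prems by auto
  then show ?case using IH wit[of \<phi> e x] Ex.prems \<open>H \<subseteq> D\<close> by auto
next
  case (All x \<phi>)
  have upd: "range (e(x := d)) \<subseteq> H" if "d \<in> H" for d using All.prems that by auto
  have IH: "sat H I (e(x := d)) \<phi> \<longleftrightarrow> sat D I (e(x := d)) \<phi>" if "d \<in> H" for d
    by (rule All.IH[OF _ upd[OF that]]) (use All.prems in auto)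
  have "Neg \<phi> \<in> S" using All.prems by auto
  then have "(\<exists>d\<in>D. \<not> sat D I (e(x := d)) \<phi>) \<longrightarrow> (\<exists>d\<in>H. \<not> sat D I (e(x := d)) \<phi>)"
    using wit[of "Neg \<phi>" e x] All.prems(2) by simp
  then show ?case using IH \<open>H \<subseteq> D\<close> unfolding sat.simps by blast
qed auto

lemma countable_hull:
  fixes D :: "'v set" and S :: "'p fm set"
  assumes "D \<noteq> {}" "countable S"
  obtains H where "H \<subseteq> D" "H \<noteq> {}" "countable H"
    "\<And>\<phi> x e. \<phi> \<in> S \<Longrightarrow> range e \<subseteq> H \<Longrightarrow> \<exists>d\<in>D. sat D I (e(x := d)) \<phi> \<Longrightarrow>
               \<exists>d\<in>H. sat D I (e(x := d)) \<phi>"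
proof -
  obtain d0 where d0: "d0 \<in> D" using assms by blast
  define env :: "'v list \<Rightarrow> nat \<Rightarrow> 'v"
    where "env xs = (\<lambda>n. if n < length xs then xs ! n else d0)" for xs
  define w where "w = (\<lambda>(\<phi>, x, xs). if \<exists>d\<in>D. sat D I ((env xs)(x := d)) \<phi>
                         then SOME d. d \<in> D \<and> sat D I ((env xs)(x := d)) \<phi> else d0)"
  have w: "w (\<phi>, x, xs) \<in> D \<and> sat D I ((env xs)(x := w (\<phi>, x, xs))) \<phi>"
    if "\<exists>d\<in>D. sat D I ((env xs)(x := d)) \<phi>" for \<phi> x xs
  proof -
    have "\<exists>d. d \<in> D \<and> sat D I ((env xs)(x := d)) \<phi>" using that by blast
    from someI_ex[OF this] show ?thesis using that by (simp add: w_def)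
  qed
  have wD: "w t \<in> D" for t
  proof (cases t)
    case (fields \<phi> x xs)
    show ?thesis
    proof (cases "\<exists>d\<in>D. sat D I ((env xs)(x := d)) \<phi>")
      case True
      then show ?thesis using w fields by blast
    next
      case False
      then show ?thesis using fields d0 by (simp add: w_def)
    qed
  qed
  define L where "L = rec_nat {d0} (\<lambda>_ A. A \<union> w ` (S \<times> UNIV \<times> lists A))"
  have L0: "L 0 = {d0}" and LS: "L (Suc n) = L n \<union> w ` (S \<times> UNIV \<times> lists (L n))" for n
    by (simp_all add: L_def)
  have cL: "countable (L n)" for n
    by (induction n) (use assms in \<open>auto simp: L0 LS\<close>)
  have LD: "L n \<subseteq> D" for n
    by (induction n) (use d0 wD in \<open>auto simp: L0 LS\<close>)
  have mono: "L m \<subseteq> L n" if "m \<le> n" for m n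
    by (rule lift_Suc_mono_le[OF _ that]) (simp add: LS)
  define H where "H = (\<Union>n. L n)"
  have fin: "\<exists>n. A \<subseteq> L n" if "finite A" "A \<subseteq> H" for A
    using that
  proof (induction A)
    case empty
    then show ?case by simp
  next
    case (insert a A)
    then obtain m n where "A \<subseteq> L n" "a \<in> L m" unfolding H_def by auto
    then have "insert a A \<subseteq> L (max m n)" using mono[of m "max m n"] mono[of n "max m n"] by auto
    then show ?case by blast
  qed
  show thesis
  proof
    show "H \<subseteq> D" using LD by (auto simp: H_def)
    show "H \<noteq> {}" using L0 by (auto simp: H_def)
    show "countable H" using cL by (auto simp: H_def)
    fix \<phi> x and e :: "nat \<Rightarrow> 'v"
    assume S: "\<phi> \<in> S" and e: "range e \<subseteq> H" and ex: "\<exists>d\<in>D. sat D I (e(x := d)) \<phi>"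
    obtain N where N: "\<forall>y\<in>fv \<phi>. y < N"
      using finite_fv[of \<phi>] finite_nat_set_iff_bounded by blast
    define xs where "xs = map e [0..<N]"
    have eq: "sat D I (e(x := d)) \<phi> \<longleftrightarrow> sat D I ((env xs)(x := d)) \<phi>" for d
      by (rule sat_cong) (use N in \<open>auto simp: env_def xs_def\<close>)
    have "set xs \<subseteq> H" using e by (auto simp: xs_def)
    then obtain n where "set xs \<subseteq> L n" using fin by blast
    then have "w (\<phi>, x, xs) \<in> L (Suc n)" using S by (auto simp: LS)
    then have "w (\<phi>, x, xs) \<in> H" unfolding H_def by blast
    moreover have "sat D I (e(x := w (\<phi>, x, xs))) \<phi>" using w ex unfolding eq by blast
    ultimately show "\<exists>d\<in>H. sat D I (e(x := d)) \<phi>" by blast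
  qed
qed

lemma entails_any_structure:
  fixes D :: "'v set"
  assumes ent: "entails TYPE('u::infinite) \<phi> \<psi>" and closed: "fv \<phi> = {}" "fv \<psi> = {}"
    and D: "D \<noteq> {}" "range e \<subseteq> D" and sat: "sat D I e \<phi>"
  shows "sat D I e \<psi>"
proof -
  obtain H where H: "H \<subseteq> D" "H \<noteq> {}" "countable H"
    and wit: "\<And>\<chi> x e. \<chi> \<in> qsub \<phi> \<union> qsub \<psi> \<Longrightarrow> range e \<subseteq> H \<Longrightarrow> \<exists>d\<in>D. sat D I (e(x := d)) \<chi> \<Longrightarrow>
               \<exists>d\<in>H. sat D I (e(x := d)) \<chi>"
    by (rule countable_hull[OF D(1), of "qsub \<phi> \<union> qsub \<psi>" I])
      (simp_all add: finite_qsub countable_finite)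
  obtain h where h: "h \<in> H" using H by blast
  obtain g :: "nat \<Rightarrow> 'u" where g: "inj g"
    using infinite_countable_subset[OF infinite_UNIV] by blast
  define f where "f = g \<circ> to_nat_on H"
  have f: "inj_on f H"
    unfolding f_def using g H(3) by (intro comp_inj_on inj_on_to_nat_on) (auto intro: inj_on_subset)
  define e' where "e' = (\<lambda>_ :: nat. h)"
  have e': "range e' \<subseteq> H" using h by (auto simp: e'_def)
  let ?I = "\<lambda>P us. I P (map (inv_into H f) us)"
  have eq: "sat (f ` H) ?I (f \<circ> e') \<chi> \<longleftrightarrow> sat D I e \<chi>"
    if "fv \<chi> = {}" "qsub \<chi> \<subseteq> qsub \<phi> \<union> qsub \<psi>" for \<chi>
  proof -
    have "sat (f ` H) ?I (f \<circ> e') \<chi> \<longleftrightarrow> sat H I e' \<chi>" by (rule sat_image[OF f e'])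
    also have "\<dots> \<longleftrightarrow> sat D I e' \<chi>" by (rule Tarski_Vaught[OF H(1) wit that(2) e'])
    also have "\<dots> \<longleftrightarrow> sat D I e \<chi>" by (rule sat_cong) (simp add: that)
    finally show ?thesis .
  qed
  have "range (f \<circ> e') \<subseteq> f ` H" using e' by auto
  moreover have "f ` H \<noteq> {}" using H(2) by simp
  ultimately have "sat (f ` H) ?I (f \<circ> e') \<phi> \<longrightarrow> sat (f ` H) ?I (f \<circ> e') \<psi>"
    using ent[unfolded entails_def, rule_format, of "f ` H" "f \<circ> e'" ?I] by (intro impI)
  then show ?thesis using eq closed sat by simp
qed

lemma entails_type_independent:
  assumes "fv \<phi> = {}" "fv \<psi> = {}"
  shows "entails TYPE('u::infinite) \<phi> \<psi> \<longleftrightarrow> entails TYPE('v::infinite) \<phi> \<psi>"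
proof
  assume ent: "entails TYPE('u) \<phi> \<psi>"
  show "entails TYPE('v) \<phi> \<psi>"
    unfolding entails_def by (intro allI impI) (rule entails_any_structure[OF ent assms])
next
  assume ent: "entails TYPE('v) \<phi> \<psi>"
  show "entails TYPE('u) \<phi> \<psi>"
    unfolding entails_def by (intro allI impI) (rule entails_any_structure[OF ent assms])
qed

end

theory Submission
  imports Defs
begin

text \<open>A consequence \<open>\<psi>\<close> of \<open>\<phi>\<^sub>2\<close> may use predicates
  outside \<open>\<Sigma>\<close>, but only ones foreign to \<open>\<phi>\<^sub>2\<close>. A Craig
  interpolant \<open>\<chi>\<close> between \<open>\<phi>\<^sub>2\<close> and \<open>\<psi>\<close>
  avoids these, so it is a \<open>\<Sigma>\<close>-consequence of \<open>\<phi>\<^sub>2\<close>. The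
  hypothesis passes \<open>\<chi>\<close> on to \<open>\<phi>\<^sub>1\<close>, and
  \<open>\<chi>\<close> yields \<open>\<psi>\<close>
  (\<open>sig_entails_imp_strongly_sig_entails\<close>).\<close>

lemma entails_trans: "entails U \<phi> \<psi> \<Longrightarrow> entails U \<psi> \<chi> \<Longrightarrow> entails U \<phi> \<chi>"
  by (simp add: entails_def)

text \<open>Instantiate \<open>\<Sigma>'\<close> with \<open>\<Sigma>\<close>; finiteness makes it
  an admissible signature.\<close>

lemma strongly_sig_entails_imp_sig_entails:
  "finite \<Sigma> \<Longrightarrow> strongly_sig_entails U F \<Sigma> \<phi>\<^sub>1 \<phi>\<^sub>2 \<Longrightarrow> sig_entails U F \<Sigma> \<phi>\<^sub>1 \<phi>\<^sub>2"
  by (simp add: strongly_sig_entails_def)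

lemma sig_entails_imp_strongly_sig_entails:
  assumes craig: "craig_interpolation U F" and \<phi>\<^sub>2: "\<phi>\<^sub>2 \<in> sentences F"
    and ent: "sig_entails U F \<Sigma> \<phi>\<^sub>1 \<phi>\<^sub>2"
  shows "strongly_sig_entails U F \<Sigma> \<phi>\<^sub>1 \<phi>\<^sub>2"
  unfolding strongly_sig_entails_def sig_entails_def
proof (intro allI impI ballI)
  fix \<Sigma>' \<psi>
  assume \<Sigma>': "\<Sigma>' \<inter> sig \<phi>\<^sub>2 \<subseteq> \<Sigma>" and "\<psi> \<in> sentences_over F \<Sigma>'" and "entails U \<phi>\<^sub>2 \<psi>"
  then have "\<psi> \<in> sentences F" "sig \<psi> \<subseteq> \<Sigma>'"
    by (simp_all add: sentences_over_def)
  with \<open>entails U \<phi>\<^sub>2 \<psi>\<close> obtain \<chi> where \<chi>: "\<chi> \<in> sentences F" "entails U \<phi>\<^sub>2 \<chi>" "entails U \<chi> \<psi>"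
      and sig_\<chi>: "sig \<chi> \<subseteq> sig \<phi>\<^sub>2 \<inter> sig \<psi>"
    using craig \<phi>\<^sub>2 unfolding craig_interpolation_def by meson
  \<comment> \<open>The interpolant's predicates are shared by \<open>\<phi>\<^sub>2\<close> and
    \<open>\<psi>\<close>, hence lie in \<open>\<Sigma>' \<inter> sig \<phi>\<^sub>2\<close>, which
    the choice of \<open>\<Sigma>'\<close> keeps inside \<open>\<Sigma>\<close>.\<close>
  have "sig \<chi> \<subseteq> \<Sigma>"
    using sig_\<chi> \<Sigma>' \<open>sig \<psi> \<subseteq> \<Sigma>'\<close> by blast
  then have "entails U \<phi>\<^sub>1 \<chi>"
    using ent \<chi> by (simp add: sig_entails_def sentences_over_def)
  then show "entails U \<phi>\<^sub>1 \<psi>"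
    using \<chi>(3) by (rule entails_trans)
qed

theorem theorem5:
  fixes ar :: "'p \<Rightarrow> nat" and F :: "'p fm set" and \<Sigma> :: "'p set" and \<phi>\<^sub>1 \<phi>\<^sub>2 :: "'p fm"
  assumes "fragment ar F"
    and "craig_interpolation TYPE('u::infinite) F"
    and "finite \<Sigma>"
    and "\<phi>\<^sub>1 \<in> sentences F"
    and "\<phi>\<^sub>2 \<in> sentences F"
  shows "(sig_entails TYPE('u) F \<Sigma> \<phi>\<^sub>1 \<phi>\<^sub>2 \<longrightarrow> strongly_sig_entails TYPE('u) F \<Sigma> \<phi>\<^sub>1 \<phi>\<^sub>2) \<and>
    (entails TYPE('u) \<phi>\<^sub>2 \<phi>\<^sub>1 \<and> sig \<phi>\<^sub>1 \<subseteq> \<Sigma> \<longrightarrow>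
      (uniform_interpolant TYPE('u) F \<Sigma> \<phi>\<^sub>2 \<phi>\<^sub>1 \<longleftrightarrow> sig_entails TYPE('u) F \<Sigma> \<phi>\<^sub>1 \<phi>\<^sub>2))"
proof -
  \<comment> \<open>This equivalence settles both claims: under the premises of the second, strong
    entailment is the only clause of \<open>uniform_interpolant\<close> still open.\<close>
  have "strongly_sig_entails TYPE('u) F \<Sigma> \<phi>\<^sub>1 \<phi>\<^sub>2 \<longleftrightarrow> sig_entails TYPE('u) F \<Sigma> \<phi>\<^sub>1 \<phi>\<^sub>2"
    using sig_entails_imp_strongly_sig_entails[OF assms(2,5)]
      strongly_sig_entails_imp_sig_entails[OF assms(3)] by (rule iffI[rotated])
  then show ?thesis
    using assms(4,5) by (simp add: uniform_interpolant_def)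
qed

end
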